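(* Let Assumption 1 hold, let $b\in\mathcal B$, and let $\mathcal V_u,\mathcal V_l\subseteq\mathbb R^K$. If $b\in\mathcal B_n^*$, then $$\text{(a)}\quad \forall v\in\mathcal V_u:\ \mathbb E\big[\mathbb E_n[(2Y-1)1\{Xb\ge0\}1\{Xv<0\}]\mid\mathcal X_n\big]\ge0,$$ and $$\text{(b)}\quad \forall v\in\mathcal V_l:\ \mathbb E\big[\mathbb E_n[(1-2Y)1\{Xb\le0\}1\{Xv>0\}]\mid\mathcal X_n\big]\ge0.$$ Moreover, if $\mathcal V_u$ and $\mathcal V_l$ contain at least one element from each member of $\mathsf V_u$ and $\mathsf V_l$, respectively, then (a) and (b) together imply $b\in\mathcal B_n^*$, so that $\mathcal B_n^*=\{b\in\mathcal B:\text{(a) and (b) hold}\}$.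
   Context: Setting. $n,K\ge 1$ are integers; $Y_i\in\{0,1\}$, $X_i$ is a row vector in $\mathbb{R}^K$, $U_i$ is real valued, $i=1,\dots,n$; $\mathcal{X}_n\equiv(X_1,\dots,X_n)$. The analysis is conditional on $\mathcal{X}_n$ (it may be read for a fixed realization of $\mathcal{X}_n$). For any expression in $(Y,X)$, $\mathbb{E}_n[\cdot]\equiv n^{-1}\sum_{i=1}^n[\cdot]$, where $(Y,X)$ is evaluated at $(Y_i,X_i)$ in the $i$th summand. Assumption 1. (i) The random vectors $(Y_i,X_i,U_i)$, $i=1,\dots,n$, are defined on a probability space $(\Omega,\mathfrak F,\mathbb P)$, where $\mathfrak F$ contains the Borel sets on $\Omega$. (ii) $(Y_i,X_i)$, $i=1,\dots,n$, are observed. (iii) There is a column vector $\beta\in\mathbb{R}^K$ such that $\mathbb P(Y_i=1\{X_i\beta+U_i\ge 0\}\mid\mathcal X_n)=1$ and $\mathbb P(U_i\ge 0\mid\mathcal X_n)=1/2$ for every $i$. (iv) $\beta$ belongs to a known set $\mathcal B\subseteq\mathbb R^K$. (v) $1\{U_1\ge0\},\dots,1\{U_n\ge0\}$ are mutually independent conditional on $\mathcal X_n$. Definition. The finite sample identified set $\mathcal B_n^*$ for $\beta$ is the set of $b\in\mathcal B$ for which there exist random variables $\tilde Y_1,\dots,\tilde Y_n$ and $\tilde U_1,\dots,\tilde U_n$ such that: (i) $\mathbb P(\tilde Y_i=1\{X_ib+\tilde U_i\ge0\}\mid\mathcal X_n)=1$ for every $i$; (ii) $(\tilde Y_1,\dots,\tilde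 Y_n)$ and $(Y_1,\dots,Y_n)$ have the same distribution conditional on $\mathcal X_n$; (iii) $\mathbb P(\tilde U_i\ge0\mid\mathcal X_n)=1/2$ for every $i$; (iv) $1\{\tilde U_1\ge0\},\dots,1\{\tilde U_n\ge0\}$ are mutually independent given $\mathcal X_n$. Partitions. Let $r_u(b)\equiv(1\{X_1b\ge0\},\dots,1\{X_nb\ge0\})$ and $r_l(b)\equiv(1\{X_1b\le0\},\dots,1\{X_nb\le0\})$. $\mathsf V_u$ (resp. $\mathsf V_l$) denotes the coimage of $r_u$ (resp. $r_l$) on $\mathcal B$, i.e. the set of equivalence classes of $\mathcal B$ under the relation $b\sim b'\iff r_u(b)=r_u(b')$ (resp. $r_l(b)=r_l(b')$). *)

theory Defs
  imports "HOL-Probability.Probability"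
begin

text \<open>
  Everything is conditional on the covariates, read at a fixed realization: \<open>X i\<close> is a fixed vector,
  and \<open>M\<close> is the sample space equipped with the conditional probability given \<open>X 1, ..., X n\<close>.
  Observations are indexed by \<open>{1..n}\<close>, and the row-times-column product \<open>X\<^sub>i b\<close> is \<open>X i \<bullet> b\<close>.
  In \<open>borel_sets\<close> the sample space carries the subspace topology.
\<close>

locale binary_response = prob_space M
  for M :: "'w::topological_space measure" +
  fixes n :: nat
    and X :: "nat \<Rightarrow> real ^ 'k"
    and Y :: "nat \<Rightarrow> 'w \<Rightarrow> real"
    and U :: "nat \<Rightarrow> 'w \<Rightarrow> real"
    and B :: "(real ^ 'k) set"
    and \<beta> :: "real ^ 'k"
  assumes n_pos: "1 \<le> n"
    and borel_sets: "sets (restrict_space borel (space M)) \<subseteq> sets M"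
    and Y_measurable: "\<And>i. i \<in> {1..n} \<Longrightarrow> Y i \<in> borel_measurable M"
    and Y_binary: "\<And>i \<omega>. i \<in> {1..n} \<Longrightarrow> \<omega> \<in> space M \<Longrightarrow> Y i \<omega> \<in> {0, 1}"
    and U_measurable: "\<And>i. i \<in> {1..n} \<Longrightarrow> U i \<in> borel_measurable M"
    and response: "\<And>i. i \<in> {1..n} \<Longrightarrow>
          prob {\<omega> \<in> space M. Y i \<omega> = of_bool (X i \<bullet> \<beta> + U i \<omega> \<ge> 0)} = 1"
    and median: "\<And>i. i \<in> {1..n} \<Longrightarrow> prob {\<omega> \<in> space M. U i \<omega> \<ge> 0} = 1 / 2"
    and beta_in: "\<beta> \<in> B"
    and indep: "indep_vars (\<lambda>_. borel) (\<lambda>i \<omega>. of_bool (U i \<omega> \<ge> 0) :: real) {1..n}"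

text \<open>
  The random variables \<open>Y'\<close>, \<open>U'\<close> live on the given probability space; that \<open>Y'\<close> is almost surely
  binary follows from the response equation.
\<close>

definition identified_set ::
  "'w measure \<Rightarrow> nat \<Rightarrow> (nat \<Rightarrow> real ^ 'k) \<Rightarrow> (nat \<Rightarrow> 'w \<Rightarrow> real) \<Rightarrow> (real ^ 'k) set \<Rightarrow> (real ^ 'k) set"
where
  "identified_set M n X Y B = {b \<in> B. \<exists>Y' U' :: nat \<Rightarrow> 'w \<Rightarrow> real.
     (\<forall>i \<in> {1..n}. Y' i \<in> borel_measurable M \<and> U' i \<in> borel_measurable M) \<and>
     (\<forall>i \<in> {1..n}. measure M {\<omega> \<in> space M. Y' i \<omega> = of_bool (X i \<bullet> b + U' i \<omega> \<ge> 0)} = 1) \<and>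
     distr M (PiM {1..n} (\<lambda>_. borel)) (\<lambda>\<omega>. \<lambda>i\<in>{1..n}. Y' i \<omega>) =
       distr M (PiM {1..n} (\<lambda>_. borel)) (\<lambda>\<omega>. \<lambda>i\<in>{1..n}. Y i \<omega>) \<and>
     (\<forall>i \<in> {1..n}. measure M {\<omega> \<in> space M. U' i \<omega> \<ge> 0} = 1 / 2) \<and>
     prob_space.indep_vars M (\<lambda>_. borel) (\<lambda>i \<omega>. of_bool (U' i \<omega> \<ge> 0) :: real) {1..n}}"

definition r_u :: "nat \<Rightarrow> (nat \<Rightarrow> real ^ 'k) \<Rightarrow> real ^ 'k \<Rightarrow> nat \<Rightarrow> real" where
  "r_u n X b = (\<lambda>i\<in>{1..n}. of_bool (X i \<bullet> b \<ge> 0))"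

definition r_l :: "nat \<Rightarrow> (nat \<Rightarrow> real ^ 'k) \<Rightarrow> real ^ 'k \<Rightarrow> nat \<Rightarrow> real" where
  "r_l n X b = (\<lambda>i\<in>{1..n}. of_bool (X i \<bullet> b \<le> 0))"

definition coimage_on :: "'a set \<Rightarrow> ('a \<Rightarrow> 'c) \<Rightarrow> 'a set set" where
  "coimage_on A f = A // {(a, a'). a \<in> A \<and> a' \<in> A \<and> f a = f a'}"

definition sample_mean ::
  "nat \<Rightarrow> (nat \<Rightarrow> real ^ 'k) \<Rightarrow> (nat \<Rightarrow> 'w \<Rightarrow> real) \<Rightarrow> (real \<Rightarrow> real ^ 'k \<Rightarrow> real) \<Rightarrow> 'w \<Rightarrow> real"
where
  "sample_mean n X Y g \<omega> = (\<Sum>i = 1..n. g (Y i \<omega>) (X i)) / real n"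

definition upper_ineqs ::
  "'w measure \<Rightarrow> nat \<Rightarrow> (nat \<Rightarrow> real ^ 'k) \<Rightarrow> (nat \<Rightarrow> 'w \<Rightarrow> real) \<Rightarrow> (real ^ 'k) set \<Rightarrow> real ^ 'k \<Rightarrow> bool"
where
  "upper_ineqs M n X Y V b \<longleftrightarrow> (\<forall>v\<in>V.
     (\<integral>\<omega>. sample_mean n X Y
        (\<lambda>y x. (2 * y - 1) * of_bool (x \<bullet> b \<ge> 0) * of_bool (x \<bullet> v < 0)) \<omega> \<partial>M) \<ge> 0)"

definition lower_ineqs ::
  "'w measure \<Rightarrow> nat \<Rightarrow> (nat \<Rightarrow> real ^ 'k) \<Rightarrow> (nat \<Rightarrow> 'w \<Rightarrow> real) \<Rightarrow> (real ^ 'k) set \<Rightarrow> real ^ 'k \<Rightarrow> bool"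
where
  "lower_ineqs M n X Y V b \<longleftrightarrow> (\<forall>v\<in>V.
     (\<integral>\<omega>. sample_mean n X Y
        (\<lambda>y x. (1 - 2 * y) * of_bool (x \<bullet> b \<le> 0) * of_bool (x \<bullet> v > 0)) \<omega> \<partial>M) \<ge> 0)"

end

theory Submission
  imports Defs
begin

text \<open>
  The sign of the index \<open>X\<^sub>i b\<close> forces \<open>P(Y\<^sub>i = 1)\<close> onto one side of \<open>1/2\<close>, which gives the inequalities.
  Conversely, use the inequalities at representatives of the cells of the true \<open>\<beta>\<close>: there every summand
  is nonpositive by the same sign restriction at \<open>\<beta>\<close>, so every summand vanishes, and
  \<open>Y\<^sub>i = 1{U\<^sub>i \<ge> 0}\<close> almost surely wherever \<open>X\<^sub>i b\<close> and \<open>X\<^sub>i \<beta>\<close> do not have the same sign.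
  Hence \<open>Y' = Y\<close> can be kept, together with the signs of the \<open>U\<^sub>i\<close> (and so their independence),
  and only the magnitudes of the \<open>U\<^sub>i\<close> need to be changed.
\<close>

section \<open>Nested events of equal probability, and the sign restriction for one
  observation\<close>

text \<open>Up to a null set \<open>P\<close> is contained in \<open>Q\<close>, so equal finite mass
  leaves nothing for the difference.\<close>

lemma (in prob_space) AE_iff_of_prob_eq:
  assumes [measurable]: "Measurable.pred M P" "Measurable.pred M Q"
    and imp: "AE \<omega> in M. P \<omega> \<longrightarrow> Q \<omega>"
    and eq: "prob {\<omega> \<in> space M. P \<omega>} = prob {\<omega> \<in> space M. Q \<omega>}"
  shows "AE \<omega> in M. P \<omega> \<longleftrightarrow> Q \<omega>"
proof -
  have "prob {\<omega> \<in> space M. Q \<omega>} = prob {\<omega> \<in> space M. P \<omega> \<or> (Q \<omega> \<and> \<not> P \<omega>)}"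
    by (rule finite_measure_eq_AE) (use imp in auto)
  also have "{\<omega> \<in> space M. P \<omega> \<or> (Q \<omega> \<and> \<not> P \<omega>)} =
      {\<omega> \<in> space M. P \<omega>} \<union> {\<omega> \<in> space M. Q \<omega> \<and> \<not> P \<omega>}"
    by auto
  also have "prob \<dots> = prob {\<omega> \<in> space M. P \<omega>} + prob {\<omega> \<in> space M. Q \<omega> \<and> \<not> P \<omega>}"
    by (rule finite_measure_Union) auto
  finally have "prob {\<omega> \<in> space M. Q \<omega> \<and> \<not> P \<omega>} = 0"
    using eq by simp
  then have "AE \<omega> in M. \<not> (Q \<omega> \<and> \<not> P \<omega>)"
    by (subst (asm) prob_eq_0) auto
  with imp show ?thesis by eventually_elim auto
qed

text \<open>One observation with index value \<open>c\<close>. It is kept abstract because it serves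
  twice: for the true pair at index \<open>X i \<bullet> \<beta>\<close> and for a candidate pair at
  index \<open>X i \<bullet> b\<close>.\<close>

locale median_response = prob_space M for M :: "'w measure" +
  fixes Y U :: "'w \<Rightarrow> real" and c :: real
  assumes Y_meas [measurable]: "Y \<in> borel_measurable M"
    and U_meas [measurable]: "U \<in> borel_measurable M"
    and resp: "prob {\<omega> \<in> space M. Y \<omega> = of_bool (c + U \<omega> \<ge> 0)} = 1"
    and med: "prob {\<omega> \<in> space M. U \<omega> \<ge> 0} = 1 / 2"
begin

lemma AE_resp: "AE \<omega> in M. Y \<omega> = of_bool (c + U \<omega> \<ge> 0)"
proof -
  have "{\<omega> \<in> space M. Y \<omega> = of_bool (c + U \<omega> \<ge> 0)} \<in> events" by measurable
  with resp show ?thesis by (subst (asm) prob_eq_1) auto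
qed

lemma AE_nonneg_imp: "c \<ge> 0 \<Longrightarrow> AE \<omega> in M. U \<omega> \<ge> 0 \<longrightarrow> Y \<omega> = 1"
  using AE_resp by eventually_elim auto

lemma AE_nonpos_imp: "c \<le> 0 \<Longrightarrow> AE \<omega> in M. Y \<omega> = 1 \<longrightarrow> U \<omega> \<ge> 0"
  using AE_resp by eventually_elim (auto simp: of_bool_def split: if_splits)

lemma prob_ge_half:
  assumes "c \<ge> 0" shows "prob {\<omega> \<in> space M. Y \<omega> = 1} \<ge> 1 / 2"
  unfolding med[symmetric]
  by (rule finite_measure_mono_AE) (use AE_nonneg_imp[OF assms] in auto)

lemma prob_le_half:
  assumes "c \<le> 0" shows "prob {\<omega> \<in> space M. Y \<omega> = 1} \<le> 1 / 2"
  unfolding med[symmetric]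
  by (rule finite_measure_mono_AE) (use AE_nonpos_imp[OF assms] in auto)

text \<open>The sign of \<open>c\<close> decides which of the events \<open>Y = 1\<close> and
  \<open>U \<ge> 0\<close> contains the other almost surely. Both have mass 1/2, so they
  coincide.\<close>

lemma AE_iff_of_half:
  assumes "prob {\<omega> \<in> space M. Y \<omega> = 1} = 1 / 2"
  shows "AE \<omega> in M. Y \<omega> = 1 \<longleftrightarrow> U \<omega> \<ge> 0"
proof (cases "c \<ge> 0")
  case True
  have "AE \<omega> in M. U \<omega> \<ge> 0 \<longleftrightarrow> Y \<omega> = 1"
    by (rule AE_iff_of_prob_eq) (use AE_nonneg_imp[OF True] assms med in auto)
  then show ?thesis by eventually_elim auto
next
  case False
  then have "c \<le> 0" by simp
  then show ?thesis
    by (intro AE_iff_of_prob_eq) (use AE_nonpos_imp assms med in auto)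
qed

end

section \<open>Marginals, and the inequalities as finite sums in P(Y_i = 1)\<close>

text \<open>The event is the preimage of a measurable cylinder, so the joint law fixes its
  probability. This carries bounds on P(Y'_i = 1) over to P(Y_i = 1).\<close>

lemma prob_eq_of_distr_PiM_eq:
  fixes Y Y' :: "'i \<Rightarrow> 'w \<Rightarrow> real"
  assumes "i \<in> I"
    and Y: "\<And>i. i \<in> I \<Longrightarrow> Y i \<in> borel_measurable M"
    and Y': "\<And>i. i \<in> I \<Longrightarrow> Y' i \<in> borel_measurable M"
    and eq: "distr M (PiM I (\<lambda>_. borel)) (\<lambda>\<omega>. \<lambda>i\<in>I. Y' i \<omega>) =
      distr M (PiM I (\<lambda>_. borel)) (\<lambda>\<omega>. \<lambda>i\<in>I. Y i \<omega>)"
  shows "measure M {\<omega> \<in> space M. Y' i \<omega> = a} = measure M {\<omega> \<in> space M. Y i \<omega> = a}"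
proof -
  let ?P = "PiM I (\<lambda>_. borel :: real measure)"
  have S: "{f \<in> space ?P. f i = a} \<in> sets ?P"
    using \<open>i \<in> I\<close> by measurable
  have *: "measure (distr M ?P (\<lambda>\<omega>. \<lambda>i\<in>I. Z i \<omega>)) {f \<in> space ?P. f i = a} =
      measure M {\<omega> \<in> space M. Z i \<omega> = a}"
    if Z: "\<And>i. i \<in> I \<Longrightarrow> Z i \<in> borel_measurable M" for Z
  proof -
    have m: "(\<lambda>\<omega>. \<lambda>i\<in>I. Z i \<omega>) \<in> measurable M ?P"
      using Z by (rule measurable_restrict)
    show ?thesis
      unfolding measure_distr[OF m S]
      by (rule arg_cong[where f = "measure M"])
        (use \<open>i \<in> I\<close> measurable_space[OF m] in auto)
  qed
  show ?thesis
    using *[of Y, OF Y] *[of Y', OF Y'] eq by simp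
qed

context binary_response
begin

lemma median_response_true: "i \<in> {1..n} \<Longrightarrow> median_response M (Y i) (U i) (X i \<bullet> \<beta>)"
  by unfold_locales (use Y_measurable U_measurable response median in auto)

lemma expectation_Y:
  assumes i: "i \<in> {1..n}"
  shows "integrable M (Y i)" and "expectation (Y i) = prob {\<omega> \<in> space M. Y i \<omega> = 1}"
proof -
  let ?A = "{\<omega> \<in> space M. Y i \<omega> = 1}"
  have [measurable]: "Y i \<in> borel_measurable M" using Y_measurable i by blast
  have A: "?A \<in> events" by measurable
  have eq: "Y i \<omega> = indicator ?A \<omega>" if "\<omega> \<in> space M" for \<omega>
    using Y_binary[OF i that] that by (auto simp: indicator_def)
  have "integrable M (Y i) \<longleftrightarrow> integrable M (indicator ?A :: 'w \<Rightarrow> real)"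
    by (rule Bochner_Integration.integrable_cong[OF refl eq])
  with A show "integrable M (Y i)" by (simp add: emeasure_eq_measure)
  have "expectation (Y i) = expectation (indicator ?A)"
    by (rule Bochner_Integration.integral_cong[OF refl eq])
  with A show "expectation (Y i) = prob ?A" by simp
qed

text \<open>With the covariates fixed, the weights \<open>h (X i)\<close> are constants, so by
  linearity the law of \<open>Y\<close> enters only through P(Y_i = 1).\<close>

lemma expectation_sample_mean:
  assumes g: "\<And>y x. g y x = (2 * y - 1) * h x"
  shows "expectation (sample_mean n X Y g) =
    (\<Sum>i = 1..n. (2 * prob {\<omega> \<in> space M. Y i \<omega> = 1} - 1) * h (X i)) / n"
proof -
  have "expectation (\<lambda>\<omega>. \<Sum>i = 1..n. (2 * Y i \<omega> - 1) * h (X i)) =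
      (\<Sum>i = 1..n. expectation (\<lambda>\<omega>. (2 * Y i \<omega> - 1) * h (X i)))"
    by (rule Bochner_Integration.integral_sum) (use expectation_Y in auto)
  also have "\<dots> = (\<Sum>i = 1..n. (2 * prob {\<omega> \<in> space M. Y i \<omega> = 1} - 1) * h (X i))"
    by (rule sum.cong) (use expectation_Y in \<open>auto simp: prob_space\<close>)
  finally show ?thesis
    by (simp add: sample_mean_def[abs_def] g)
qed

lemma upper_ineqs_iff:
  "upper_ineqs M n X Y V b \<longleftrightarrow> (\<forall>v\<in>V. 0 \<le> (\<Sum>i = 1..n.
     (2 * prob {\<omega> \<in> space M. Y i \<omega> = 1} - 1) * (of_bool (X i \<bullet> b \<ge> 0) * of_bool (X i \<bullet> v < 0))))"
proof -
  have "expectation (sample_mean n X Y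
      (\<lambda>y x. (2 * y - 1) * of_bool (x \<bullet> b \<ge> 0) * of_bool (x \<bullet> v < 0))) =
    (\<Sum>i = 1..n. (2 * prob {\<omega> \<in> space M. Y i \<omega> = 1} - 1) *
      (of_bool (X i \<bullet> b \<ge> 0) * of_bool (X i \<bullet> v < 0))) / n" for v
    by (rule expectation_sample_mean) simp
  with n_pos show ?thesis
    unfolding upper_ineqs_def by (simp add: zero_le_divide_iff)
qed

text \<open>The sign of \<open>1 - 2 * y\<close> is moved into the weight, so that both families
  share the factor 2 P(Y_i = 1) - 1.\<close>

lemma lower_ineqs_iff:
  "lower_ineqs M n X Y V b \<longleftrightarrow> (\<forall>v\<in>V. 0 \<le> (\<Sum>i = 1..n.
     (2 * prob {\<omega> \<in> space M. Y i \<omega> = 1} - 1) * - (of_bool (X i \<bullet> b \<le> 0) * of_bool (X i \<bullet> v > 0))))"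
proof -
  have "expectation (sample_mean n X Y
      (\<lambda>y x. (1 - 2 * y) * of_bool (x \<bullet> b \<le> 0) * of_bool (x \<bullet> v > 0))) =
    (\<Sum>i = 1..n. (2 * prob {\<omega> \<in> space M. Y i \<omega> = 1} - 1) *
      - (of_bool (X i \<bullet> b \<le> 0) * of_bool (X i \<bullet> v > 0))) / n" for v
    by (rule expectation_sample_mean[where h = "\<lambda>x. - (of_bool (x \<bullet> b \<le> 0) * of_bool (x \<bullet> v > 0))"])
      (simp add: of_bool_def)
  with n_pos show ?thesis
    unfolding lower_ineqs_def by (simp only: zero_le_divide_iff) auto
qed

section \<open>Necessity of the inequalities\<close>

text \<open>Every summand is nonnegative on its own: the sign restriction at \<open>b\<close> holds
  for the candidate pair and passes to \<open>Y\<close> through equal marginals. Hence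
  \<open>V\<close> can be arbitrary.\<close>

lemma ineqs_of_identified:
  assumes "b \<in> identified_set M n X Y B"
  shows "upper_ineqs M n X Y V b" and "lower_ineqs M n X Y V b"
proof -
  obtain Y' U' :: "nat \<Rightarrow> 'w \<Rightarrow> real" where
    m: "\<And>i. i \<in> {1..n} \<Longrightarrow> Y' i \<in> borel_measurable M" "\<And>i. i \<in> {1..n} \<Longrightarrow> U' i \<in> borel_measurable M"
    and r: "\<And>i. i \<in> {1..n} \<Longrightarrow>
      prob {\<omega> \<in> space M. Y' i \<omega> = of_bool (X i \<bullet> b + U' i \<omega> \<ge> 0)} = 1"
    and d: "distr M (PiM {1..n} (\<lambda>_. borel)) (\<lambda>\<omega>. \<lambda>i\<in>{1..n}. Y' i \<omega>) =
       distr M (PiM {1..n} (\<lambda>_. borel)) (\<lambda>\<omega>. \<lambda>i\<in>{1..n}. Y i \<omega>)"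
    and h: "\<And>i. i \<in> {1..n} \<Longrightarrow> prob {\<omega> \<in> space M. U' i \<omega> \<ge> 0} = 1 / 2"
    using assms unfolding identified_set_def by blast
  have mr: "median_response M (Y' i) (U' i) (X i \<bullet> b)" if "i \<in> {1..n}" for i
    by unfold_locales (use m r h that in auto)
  have e: "prob {\<omega> \<in> space M. Y' i \<omega> = 1} = prob {\<omega> \<in> space M. Y i \<omega> = 1}" if "i \<in> {1..n}" for i
    by (rule prob_eq_of_distr_PiM_eq[OF that Y_measurable m(1) d])
  have ge: "prob {\<omega> \<in> space M. Y i \<omega> = 1} \<ge> 1 / 2" if "i \<in> {1..n}" "X i \<bullet> b \<ge> 0" for i
    using median_response.prob_ge_half[OF mr[OF that(1)] that(2)] e[OF that(1)] by simp
  have le: "prob {\<omega> \<in> space M. Y i \<omega> = 1} \<le> 1 / 2" if "i \<in> {1..n}" "X i \<bullet> b \<le> 0" for i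
    using median_response.prob_le_half[OF mr[OF that(1)] that(2)] e[OF that(1)] by simp
  show "upper_ineqs M n X Y V b"
    unfolding upper_ineqs_iff using ge by (intro ballI sum_nonneg) (force simp: of_bool_def)
  show "lower_ineqs M n X Y V b"
    unfolding lower_ineqs_iff using le by (intro ballI sum_nonneg) (force simp: of_bool_def)
qed

section \<open>Sufficiency of the inequalities at representatives of the cells\<close>

text \<open>Since \<beta> lies in \<open>B\<close>, its own cell belongs to the coimage and
  therefore meets \<open>V\<close>.\<close>

lemma representative_of_true:
  assumes "\<forall>C \<in> coimage_on B f. V \<inter> C \<noteq> {}"
  obtains v where "v \<in> V" "f v = f \<beta>"
proof -
  let ?R = "{(a, a'). a \<in> B \<and> a' \<in> B \<and> f a = f a'}"
  have "?R `` {\<beta>} \<in> coimage_on B f"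
    unfolding coimage_on_def by (rule quotientI[OF beta_in])
  with assms obtain v where "v \<in> V" "v \<in> ?R `` {\<beta>}" by blast
  then show ?thesis by (intro that) auto
qed

lemma half_of_upper_ineqs:
  assumes "\<forall>C \<in> coimage_on B (r_u n X). V \<inter> C \<noteq> {}"
    and "upper_ineqs M n X Y V b"
    and i: "i \<in> {1..n}" "X i \<bullet> b \<ge> 0" "X i \<bullet> \<beta> < 0"
  shows "prob {\<omega> \<in> space M. Y i \<omega> = 1} = 1 / 2"
proof -
  obtain v where v: "v \<in> V" "r_u n X v = r_u n X \<beta>"
    using representative_of_true[OF assms(1)] .
  \<comment> \<open>\<open>r_u\<close> records the weak sign, whose negation is exactly the strict
    indicator in the upper inequalities; so \<open>v\<close> can stand in for \<beta> there.\<close>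
  have sgn: "X j \<bullet> v < 0 \<longleftrightarrow> X j \<bullet> \<beta> < 0" if "j \<in> {1..n}" for j
    using fun_cong[OF v(2), of j] that
    by (auto simp: r_u_def of_bool_def split: if_splits)
  let ?t = "\<lambda>i. (2 * prob {\<omega> \<in> space M. Y i \<omega> = 1} - 1) *
    (of_bool (X i \<bullet> b \<ge> 0) * of_bool (X i \<bullet> v < 0))"
  have np: "?t j \<le> 0" if "j \<in> {1..n}" for j
    using median_response.prob_le_half[OF median_response_true[OF that]] sgn[OF that]
    by (auto simp: of_bool_def)
  have "0 \<le> sum ?t {1..n}"
    using assms(2) v(1) unfolding upper_ineqs_iff by blast
  \<comment> \<open>Dropping the other nonpositive summands squeezes the \<open>i\<close>-th one
    between 0 and 0; its weight is 1, which leaves P(Y_i = 1) = 1/2.\<close>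
  moreover have "sum ?t {1..n} \<le> ?t i"
    using np i(1) by (subst sum.remove[of _ i]) (auto intro!: sum_nonpos)
  ultimately have "?t i = 0"
    using np[OF i(1)] by linarith
  then show ?thesis using i sgn[OF i(1)] by simp
qed

text \<open>Mirror image of the upper case: the negation of the weak sign in \<open>r_l\<close> is
  the strict indicator \<open>X i \<bullet> v > 0\<close>, and the minus sign in the weight makes
  the summands nonpositive.\<close>

lemma half_of_lower_ineqs:
  assumes "\<forall>C \<in> coimage_on B (r_l n X). V \<inter> C \<noteq> {}"
    and "lower_ineqs M n X Y V b"
    and i: "i \<in> {1..n}" "X i \<bullet> b \<le> 0" "X i \<bullet> \<beta> > 0"
  shows "prob {\<omega> \<in> space M. Y i \<omega> = 1} = 1 / 2"
proof -
  obtain v where v: "v \<in> V" "r_l n X v = r_l n X \<beta>"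
    using representative_of_true[OF assms(1)] .
  have sgn: "X j \<bullet> v > 0 \<longleftrightarrow> X j \<bullet> \<beta> > 0" if "j \<in> {1..n}" for j
    using fun_cong[OF v(2), of j] that
    by (auto simp: r_l_def of_bool_def split: if_splits)
  let ?t = "\<lambda>i. (2 * prob {\<omega> \<in> space M. Y i \<omega> = 1} - 1) *
    - (of_bool (X i \<bullet> b \<le> 0) * of_bool (X i \<bullet> v > 0))"
  have np: "?t j \<le> 0" if "j \<in> {1..n}" for j
    using median_response.prob_ge_half[OF median_response_true[OF that]] sgn[OF that]
    by (auto simp: of_bool_def)
  have "0 \<le> sum ?t {1..n}"
    using assms(2) v(1) unfolding lower_ineqs_iff by blast
  moreover have "sum ?t {1..n} \<le> ?t i"
    using np i(1) by (subst sum.remove[of _ i]) (auto intro!: sum_nonpos)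
  ultimately have "?t i = 0"
    using np[OF i(1)] by linarith
  then show ?thesis using i sgn[OF i(1)] by simp
qed

lemma identified_of_ineqs:
  assumes cu: "\<forall>C \<in> coimage_on B (r_u n X). V\<^sub>u \<inter> C \<noteq> {}"
    and cl: "\<forall>C \<in> coimage_on B (r_l n X). V\<^sub>l \<inter> C \<noteq> {}"
    and u: "upper_ineqs M n X Y V\<^sub>u b"
    and l: "lower_ineqs M n X Y V\<^sub>l b"
    and b: "b \<in> B"
  shows "b \<in> identified_set M n X Y B"
proof -
  \<comment> \<open>The mixed cases are only reached, up to null sets, with \<open>X\<^sub>i b > 0\<close> in the second
    and \<open>X\<^sub>i b < 0\<close> in the third branch.\<close>
  define U' where "U' = (\<lambda>i \<omega>.
    if Y i \<omega> = 1 then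
      if U i \<omega> \<ge> 0 then \<bar>X i \<bullet> b\<bar> else if X i \<bullet> b > 0 then - (X i \<bullet> b) else - 1
    else
      if U i \<omega> \<ge> 0 then 0 else - \<bar>X i \<bullet> b\<bar> - 1)"
  \<comment> \<open>The signs agree at every point, not just almost surely, so the median condition
    and independence carry over by rewriting.\<close>
  have sgn: "U' i \<omega> \<ge> 0 \<longleftrightarrow> U i \<omega> \<ge> 0" for i \<omega>
    by (auto simp: U'_def)
  have mU: "U' i \<in> borel_measurable M" if "i \<in> {1..n}" for i
  proof -
    have [measurable]: "Y i \<in> borel_measurable M" "U i \<in> borel_measurable M"
      using Y_measurable U_measurable that by auto
    show ?thesis unfolding U'_def by measurable
  qed
  have resp: "prob {\<omega> \<in> space M. Y i \<omega> = of_bool (X i \<bullet> b + U' i \<omega> \<ge> 0)} = 1"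
    if i: "i \<in> {1..n}" for i
  proof -
    interpret R: median_response M "Y i" "U i" "X i \<bullet> \<beta>"
      by (rule median_response_true[OF i])
    note [measurable] = mU[OF i]
    \<comment> \<open>If the index at \<beta> is nonnegative too, the true response equation
      suffices; if the signs clash, the probability is 1/2 and the two events coincide.\<close>
    have up: "AE \<omega> in M. Y i \<omega> \<noteq> 1 \<longrightarrow> U i \<omega> < 0" if "X i \<bullet> b \<ge> 0"
    proof (cases "X i \<bullet> \<beta> \<ge> 0")
      case True
      from R.AE_nonneg_imp[OF this] show ?thesis by eventually_elim auto
    next
      case False
      then have "AE \<omega> in M. Y i \<omega> = 1 \<longleftrightarrow> U i \<omega> \<ge> 0"
        by (intro R.AE_iff_of_half half_of_upper_ineqs[OF cu u i that]) simp
      then show ?thesis by eventually_elim auto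
    qed
    have lo: "AE \<omega> in M. Y i \<omega> = 1 \<longrightarrow> U i \<omega> \<ge> 0" if "X i \<bullet> b \<le> 0"
    proof (cases "X i \<bullet> \<beta> \<le> 0")
      case True
      then show ?thesis by (rule R.AE_nonpos_imp)
    next
      case False
      then have "AE \<omega> in M. Y i \<omega> = 1 \<longleftrightarrow> U i \<omega> \<ge> 0"
        by (intro R.AE_iff_of_half half_of_lower_ineqs[OF cl l i that]) simp
      then show ?thesis by eventually_elim auto
    qed
    have "AE \<omega> in M. (X i \<bullet> b \<ge> 0 \<longrightarrow> Y i \<omega> \<noteq> 1 \<longrightarrow> U i \<omega> < 0) \<and>
        (X i \<bullet> b \<le> 0 \<longrightarrow> Y i \<omega> = 1 \<longrightarrow> U i \<omega> \<ge> 0)"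
      using up lo by (cases "X i \<bullet> b" "0 :: real" rule: linorder_cases) auto
    \<comment> \<open>In the order of the branches of \<open>U'\<close>, the new latent index is
      nonnegative; exactly 0 (here \<open>lo\<close> forces \<open>X i \<bullet> b > 0\<close>);
      equal to \<open>X i \<bullet> b\<close>, which \<open>up\<close> makes negative; at most -1.
      The value -1 for \<open>U'\<close> itself is a default on a null set that only preserves the
      sign.\<close>
    then have "AE \<omega> in M. Y i \<omega> = of_bool (X i \<bullet> b + U' i \<omega> \<ge> 0)"
      using AE_space
    proof eventually_elim
      case (elim \<omega>)
      with Y_binary[OF i, of \<omega>] show ?case
        by (cases "Y i \<omega> = 1"; cases "U i \<omega> \<ge> 0") (auto simp: U'_def)
    qed
    moreover have "{\<omega> \<in> space M. Y i \<omega> = of_bool (X i \<bullet> b + U' i \<omega> \<ge> 0)} \<in> events"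
      by measurable
    ultimately show ?thesis by (subst prob_eq_1) auto
  qed
  show ?thesis
    unfolding identified_set_def
    using b Y_measurable mU resp median indep
    by (intro CollectI conjI exI[of _ Y] exI[of _ U'])
      (simp_all add: sgn)
qed

end

theorem theorem2:
  fixes M :: "'w::topological_space measure"
    and n :: nat
    and X :: "nat \<Rightarrow> real ^ 'k"
    and Y U :: "nat \<Rightarrow> 'w \<Rightarrow> real"
    and B V\<^sub>u V\<^sub>l :: "(real ^ 'k) set"
    and \<beta> b :: "real ^ 'k"
  assumes "binary_response M n X Y U B \<beta>"
    and "b \<in> B"
  shows "(b \<in> identified_set M n X Y B \<longrightarrow>
            upper_ineqs M n X Y V\<^sub>u b \<and> lower_ineqs M n X Y V\<^sub>l b) \<and>
         ((\<forall>C \<in> coimage_on B (r_u n X). V\<^sub>u \<inter> C \<noteq> {}) \<and>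
          (\<forall>C \<in> coimage_on B (r_l n X). V\<^sub>l \<inter> C \<noteq> {}) \<longrightarrow>
            (upper_ineqs M n X Y V\<^sub>u b \<and> lower_ineqs M n X Y V\<^sub>l b \<longrightarrow>
               b \<in> identified_set M n X Y B) \<and>
            identified_set M n X Y B =
              {b' \<in> B. upper_ineqs M n X Y V\<^sub>u b' \<and> lower_ineqs M n X Y V\<^sub>l b'})"
proof -
  interpret binary_response M n X Y U B \<beta> by (rule assms(1))
  have B: "b' \<in> B" if "b' \<in> identified_set M n X Y B" for b'
    using that unfolding identified_set_def by blast
  have iff: "b' \<in> identified_set M n X Y B \<longleftrightarrow>
      b' \<in> B \<and> upper_ineqs M n X Y V\<^sub>u b' \<and> lower_ineqs M n X Y V\<^sub>l b'"
    if "\<forall>C \<in> coimage_on B (r_u n X). V\<^sub>u \<inter> C \<noteq> {}"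
      "\<forall>C \<in> coimage_on B (r_l n X). V\<^sub>l \<inter> C \<noteq> {}" for b'
    using B ineqs_of_identified identified_of_ineqs[OF that] by metis
  show ?thesis
  proof (intro conjI impI)
    show "identified_set M n X Y B =
        {b' \<in> B. upper_ineqs M n X Y V\<^sub>u b' \<and> lower_ineqs M n X Y V\<^sub>l b'}"
      if "(\<forall>C \<in> coimage_on B (r_u n X). V\<^sub>u \<inter> C \<noteq> {}) \<and>
        (\<forall>C \<in> coimage_on B (r_l n X). V\<^sub>l \<inter> C \<noteq> {})"
      using iff that by (intro set_eqI) simp
  qed (use ineqs_of_identified iff assms(2) in blast)+
qed

end
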